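(* Assume the Axiom of Choice. Let $X$ and $Y$ be nonempty sets, let $D$ be a nonempty subset of $X^*$, and let $F\colon X^*\to Y$ be a function. The following assertions are equivalent. (i) $F$ is preassociative and has a $D$-determined range. (ii) $F$ is in $\mathcal{P}'_D$ and has a $D$-determined range. (iii) There exist an associative and $D$-valued function $H\colon X^*\to X^*$ and a one-to-one function $f\colon\mathrm{ran}(H)\to Y$ such that $F=f\circ H$. (iv) There exist a function $H\in\mathcal{A}'_D$ with a $D$-determined range and a one-to-one function $f\colon\mathrm{ran}(H)\to Y$ such that $F=f\circ H$. (v) There exist an associative function $H\colon X^*\to X^*$ with a $D$-determined range and a one-to-one function $f\colon\mathrm{ran}(H)\to Y$ such that $F=f\circ H$.
   Context: For a nonempty set $X$, $X^*=\bigcup_{n\geqslant 0}X^n$ is the set of all finite strings (tuples) over $X$, including the empty string $\varepsilon$ ($X^0=\{\varepsilon\}$), endowed with concatenation, written by juxtaposition, with neutral element $\varepsilon$. $\mathrm{ran}(F)$ denotes the range of $F$; ranges are arbitrary sets (not assumed to be contained in $X^*$) unless specified. A function $F\colon X^*\to X^*$ is associative if $F(\mathbf{x}\mathbf{y}\mathbf{z})=F(\mathbf{x}F(\mathbf{y})\mathbf{z})$ for all $\mathbf{x},\mathbf{y},\mathbf{z}\in X^*$. A function $F\colon X^*\to Y$ is preassociative if for all $\mathbf{x},\mathbf{y},\mathbf{y}',\mathbf{z}\in X^*$, $F(\mathbf{y})=F(\mathbf{y}')$ implies $F(\mathbf{x}\mathbf{y}\mathbf{z})=F(\mathbf{x}\mathbf{y}'\mathbf{z})$.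 For a nonempty $D\subseteq X^*$: $\mathcal{A}'_D$ is the class of functions $F\colon X^*\to\mathrm{ran}(F)$ such that $F(D)\subseteq X^*$ and $F(\mathbf{x}\mathbf{y}\mathbf{z})=F(\mathbf{x}F(\mathbf{y})\mathbf{z})$ for all $\mathbf{x},\mathbf{y},\mathbf{z}\in X^*$ with $F(\mathbf{y})\in F(D)$. $\mathcal{P}'_D$ is the class of functions $F\colon X^*\to\mathrm{ran}(F)$ such that for all $\mathbf{x},\mathbf{y},\mathbf{y}',\mathbf{z}\in X^*$ with $\mathbf{y}\in D$, $F(\mathbf{y})=F(\mathbf{y}')$ implies $F(\mathbf{x}\mathbf{y}\mathbf{z})=F(\mathbf{x}\mathbf{y}'\mathbf{z})$ (here $\mathbf{y}'$ is not required to lie in $D$). Membership of a function $F\colon X^*\to Y$ in such a class is understood by regarding $F$ as a function onto its range (the codomain plays no role). A map $F\colon X^*\to Y$ is $D$-valued if $\mathrm{ran}(F)\subseteq D$, and has a $D$-determined range if $\mathrm{ran}(F)=F(D)$. *)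

theory Defs
  imports Main
begin

text \<open>
  The nonempty sets \<open>X\<close> and \<open>Y\<close> are types, \<open>X\<^sup>*\<close> is the type of lists over \<open>X\<close>
  and concatenation of strings is append.
\<close>

definition associative :: "('a list \<Rightarrow> 'a list) \<Rightarrow> bool" where
  "associative F \<longleftrightarrow> (\<forall>x y z. F (x @ y @ z) = F (x @ F y @ z))"

definition preassociative :: "('a list \<Rightarrow> 'b) \<Rightarrow> bool" where
  "preassociative F \<longleftrightarrow>
     (\<forall>x y y' z. F y = F y' \<longrightarrow> F (x @ y @ z) = F (x @ y' @ z))"

text \<open>
  Functions in \<open>class_A' D\<close> may take values outside \<open>X\<^sup>*\<close>.  An ambient set containing
  \<open>X\<^sup>*\<close> is rendered as a sum type, where \<^const>\<open>Inl\<close> is the inclusion of \<open>X\<^sup>*\<close> and the type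
  \<open>'c\<close> holds the values that are not strings.  The first condition makes every value in
  \<open>F ` D\<close> a string, so the string \<open>w\<close> below exists whenever \<open>F y \<in> F ` D\<close>.
\<close>

definition class_A' :: "'a list set \<Rightarrow> ('a list \<Rightarrow> 'a list + 'c) set" where
  "class_A' D = {F. F ` D \<subseteq> range Inl \<and>
     (\<forall>x y z w. F y \<in> F ` D \<longrightarrow> F y = Inl w \<longrightarrow> F (x @ y @ z) = F (x @ w @ z))}"

definition class_P' :: "'a list set \<Rightarrow> ('a list \<Rightarrow> 'b) set" where
  "class_P' D = {F. \<forall>x y y' z. y \<in> D \<longrightarrow> F y = F y' \<longrightarrow> F (x @ y @ z) = F (x @ y' @ z)}"

definition valued_in :: "'a list set \<Rightarrow> ('a list \<Rightarrow> 'a list) \<Rightarrow> bool" where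
  "valued_in D F \<longleftrightarrow> range F \<subseteq> D"

definition determined_range :: "'a list set \<Rightarrow> ('a list \<Rightarrow> 'b) \<Rightarrow> bool" where
  "determined_range D F \<longleftrightarrow> range F = F ` D"

end

theory Submission
  imports Defs
begin

text \<open>
  Any map choosing for each value of \<open>F\<close> a preimage in \<open>D\<close> is a right inverse \<open>g\<close> of \<open>F\<close>,
  since the range of \<open>F\<close> is determined by \<open>D\<close>.  Then \<open>H = g \<circ> F\<close> satisfies \<open>F \<circ> H = F\<close>, so
  \<open>F\<close> itself serves as the injective outer function, and preassociativity of \<open>F\<close> becomes
  associativity of \<open>H\<close>.
\<close>

text \<open>A value shared by \<open>y\<close> and \<open>y'\<close> is also taken at some
  \<open>d\<close> in \<open>D\<close>, so the condition of \<open>class_P'\<close> applies twice,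
  linking \<open>y\<close> to \<open>d\<close> and \<open>d\<close> to \<open>y'\<close>.\<close>

lemma preassociative_iff_class_P':
  assumes "determined_range D F"
  shows "preassociative F \<longleftrightarrow> F \<in> class_P' D"
proof
  assume "F \<in> class_P' D"
  then have P: "F (x @ d @ z) = F (x @ y @ z)" if "d \<in> D" "F d = F y" for d x y z
    using that unfolding class_P'_def by blast
  show "preassociative F"
    unfolding preassociative_def
  proof (intro allI impI)
    fix x y y' z
    assume eq: "F y = F y'"
    have "F y \<in> F ` D"
      using assms unfolding determined_range_def by blast
    then obtain d where "d \<in> D" "F d = F y"
      by fastforce
    then show "F (x @ y @ z) = F (x @ y' @ z)"
      using P[of d] eq by metis
  qed
qed (unfold preassociative_def class_P'_def, blast)

lemma preassociative_comp_iff: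
  assumes "inj_on f (range H)"
  shows "preassociative (f \<circ> H) \<longleftrightarrow> preassociative H"
  using assms unfolding preassociative_def by (simp add: inj_on_eq_iff)

lemma determined_range_comp:
  "determined_range D H \<Longrightarrow> determined_range D (f \<circ> H)"
  unfolding determined_range_def by (simp only: image_comp [symmetric])

text \<open>By associativity, \<open>H (x @ y @ z)\<close> depends on \<open>y\<close> only through
  \<open>H y\<close>.\<close>

lemma associative_preassociative: "associative H \<Longrightarrow> preassociative H"
  unfolding associative_def preassociative_def by metis

text \<open>Empty outer strings in the associativity law make \<open>H\<close> idempotent, so each
  value \<open>H x\<close> is the image of itself, a member of \<open>D\<close>.\<close>

lemma associative_valued_determined_range:
  assumes "associative H" and "valued_in D H"
  shows "determined_range D H"
proof -
  have "H (H x) = H x" for x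
    using assms(1) unfolding associative_def by (metis append_Nil append_Nil2)
  then have "H x \<in> H ` D" for x
    using assms(2) unfolding valued_in_def by (metis imageI rangeI subsetD)
  then show ?thesis
    unfolding determined_range_def by blast
qed

lemma class_A'_preassociative:
  assumes "H \<in> class_A' D" and "determined_range D H"
  shows "preassociative H"
  unfolding preassociative_def
proof (intro allI impI)
  fix x y y' z
  assume eq: "H y = H y'"
  have D: "H u \<in> H ` D" for u
    using assms(2) unfolding determined_range_def by blast
  obtain w where "H y = Inl w"
    using D[of y] assms(1) unfolding class_A'_def by blast
  then show "H (x @ y @ z) = H (x @ y' @ z)"
    using D eq assms(1) unfolding class_A'_def by simp
qed

lemma associative_Inl_class_A':
  "associative H \<Longrightarrow> Inl \<circ> H \<in> class_A' D"
  unfolding associative_def class_A'_def by auto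

lemma preassociative_factorization:
  assumes "preassociative F" and "determined_range D F"
  obtains H where "associative H" "valued_in D H" "inj_on F (range H)" "F = F \<circ> H"
proof
  define H where "H = inv_into D F \<circ> F"
  have mem: "F x \<in> F ` D" for x
    using assms(2) unfolding determined_range_def by blast
  have FH: "F (H x) = F x" for x
    using f_inv_into_f[OF mem] by (simp add: H_def)
  show "F = F \<circ> H"
    by (simp add: fun_eq_iff FH)
  \<comment> \<open>If \<open>F\<close> agrees at \<open>H u\<close> and \<open>H v\<close>, then
    \<open>F u = F v\<close>, and applying the chosen right inverse gives
    \<open>H u = H v\<close>.\<close>
  show "inj_on F (range H)"
    using FH by (auto simp: inj_on_def) (simp add: H_def)
  show "valued_in D H"
    using inv_into_into[OF mem] by (auto simp: valued_in_def H_def)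
  \<comment> \<open>Preassociativity is applied to \<open>y\<close> and \<open>H y\<close>, which
    have the same value under \<open>F\<close>; the right inverse then turns this into associativity
    of \<open>H\<close>.\<close>
  have "F (x @ y @ z) = F (x @ H y @ z)" for x y z
    using assms(1) FH unfolding preassociative_def by metis
  then show "associative H"
    unfolding associative_def by (simp add: H_def)
qed

theorem theorem4p3:
  fixes F :: "'a list \<Rightarrow> 'b" and D :: "'a list set"
  assumes "D \<noteq> {}"
  shows
    "(preassociative F \<and> determined_range D F
        \<longleftrightarrow> F \<in> class_P' D \<and> determined_range D F)
   \<and> (preassociative F \<and> determined_range D F
        \<longleftrightarrow> (\<exists>(H :: 'a list \<Rightarrow> 'a list) (f :: 'a list \<Rightarrow> 'b).
               associative H \<and> valued_in D H \<and> inj_on f (range H) \<and> F = f \<circ> H))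
   \<and> (preassociative F \<and> determined_range D F
        \<longleftrightarrow> (\<exists>(H :: 'a list \<Rightarrow> 'a list + 'c) (f :: 'a list + 'c \<Rightarrow> 'b).
               H \<in> class_A' D \<and> determined_range D H \<and> inj_on f (range H) \<and> F = f \<circ> H))
   \<and> (preassociative F \<and> determined_range D F
        \<longleftrightarrow> (\<exists>(H :: 'a list \<Rightarrow> 'a list) (f :: 'a list \<Rightarrow> 'b).
               associative H \<and> determined_range D H \<and> inj_on f (range H) \<and> F = f \<circ> H))"
proof (intro conjI)
  let ?i = "preassociative F \<and> determined_range D F"
  \<comment> \<open>This is (v) to (i); it also yields (iii) to (i), as associative
    \<open>D\<close>-valued maps have a \<open>D\<close>-determined range.\<close>
  have backward: ?i
    if "associative H" "determined_range D H" "inj_on f (range H)" "F = f \<circ> H"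
    for H and f :: "'a list \<Rightarrow> 'b"
    using that associative_preassociative preassociative_comp_iff determined_range_comp by blast
  show "?i \<longleftrightarrow> F \<in> class_P' D \<and> determined_range D F"
    using preassociative_iff_class_P' by blast
  show "?i \<longleftrightarrow> (\<exists>(H :: 'a list \<Rightarrow> 'a list) (f :: 'a list \<Rightarrow> 'b).
      associative H \<and> valued_in D H \<and> inj_on f (range H) \<and> F = f \<circ> H)"
    using preassociative_factorization backward associative_valued_determined_range by metis
  show "?i \<longleftrightarrow> (\<exists>(H :: 'a list \<Rightarrow> 'a list) (f :: 'a list \<Rightarrow> 'b).
      associative H \<and> determined_range D H \<and> inj_on f (range H) \<and> F = f \<circ> H)"
    using preassociative_factorization backward associative_valued_determined_range by metis
  show "?i \<longleftrightarrow> (\<exists>(H :: 'a list \<Rightarrow> 'a list + 'c) (f :: 'a list + 'c \<Rightarrow> 'b).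
      H \<in> class_A' D \<and> determined_range D H \<and> inj_on f (range H) \<and> F = f \<circ> H)"
    (is "_ \<longleftrightarrow> ?iv")
  proof
    assume ?i
    then obtain H where H: "associative H" "valued_in D H" "inj_on F (range H)" "F = F \<circ> H"
      using preassociative_factorization by blast
    \<comment> \<open>All values of \<open>?H\<close> are strings, so \<open>?f\<close> is evaluated
      on \<open>range ?H\<close> only through its branch \<open>F\<close>, and injectivity there
      comes from that of \<open>F\<close> on \<open>range H\<close>.\<close>
    let ?H = "Inl \<circ> H :: 'a list \<Rightarrow> 'a list + 'c" and ?f = "case_sum F undefined"
    have "?H \<in> class_A' D" "determined_range D ?H"
      using H associative_Inl_class_A' associative_valued_determined_range determined_range_comp
      by blast+
    moreover have "inj_on ?f (range ?H)"
      using H(3) by (auto simp: inj_on_def)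
    moreover have "F = ?f \<circ> ?H"
      using H(4) by (simp add: fun_eq_iff)
    ultimately show ?iv by blast
  next
    assume ?iv
    then show ?i
      using class_A'_preassociative preassociative_comp_iff determined_range_comp by blast
  qed
qed

end
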